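(* Let $X$ be a quandle of finite cardinality and let $\mathbf{k}$ be a Noetherian (associative, unital) ring. Then $\mathbf{k}[X]$ is both a left and a right Noetherian ring.
   Context: A quandle is a set $X$ with a binary operation $\triangleright$ such that: (I) $a\triangleright a=a$ for all $a\in X$; (II) for all $a,b\in X$ there is a unique $c\in X$ with $a=c\triangleright b$; (III) $(a\triangleright b)\triangleright c=(a\triangleright c)\triangleright(b\triangleright c)$ for all $a,b,c\in X$. The quandle ring $\mathbf{k}[X]$ is the set of finite formal sums $\sum_{x\in X}a_x x$, $a_x\in\mathbf{k}$, with the natural addition and the (generally nonassociative) multiplication $\left(\sum_{x}a_x x\right)\cdot\left(\sum_{y}b_y y\right)=\sum_{x,y}a_xb_y\,(x\triangleright y)$. A left (resp. right) ideal of $\mathbf{k}[X]$ is a left (resp. right) $\mathbf{k}$-submodule $I\subseteq\mathbf{k}[X]$ with $\mathbf{k}[X]\cdot I\subseteq I$ (resp. $I\cdot\mathbf{k}[X]\subseteq I$). The ring $\mathbf{k}[X]$ is left (resp. right) Noetherian if every ascending chain of left (resp. right) ideals stabilizes. If $\mathbf{k}$ is not commutative, Noetherian for $\mathbf{k}$ means both left and right Noetherian. *)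

theory Defs
  imports "HOL-Algebra.AbelCoset" "HOL-Library.FuncSet"
begin

locale quandle =
  fixes X :: "'x set" and qop :: "'x \<Rightarrow> 'x \<Rightarrow> 'x" (infixl "\<triangleright>" 70)
  assumes closed: "a \<in> X \<Longrightarrow> b \<in> X \<Longrightarrow> a \<triangleright> b \<in> X"
    and idem: "a \<in> X \<Longrightarrow> a \<triangleright> a = a"
    and right_div: "a \<in> X \<Longrightarrow> b \<in> X \<Longrightarrow> \<exists>!c. c \<in> X \<and> a = c \<triangleright> b"
    and self_distrib: "a \<in> X \<Longrightarrow> b \<in> X \<Longrightarrow> c \<in> X \<Longrightarrow>
      (a \<triangleright> b) \<triangleright> c = (a \<triangleright> c) \<triangleright> (b \<triangleright> c)"

definition supp :: "('k, 'm) ring_scheme \<Rightarrow> 'x set \<Rightarrow> ('x \<Rightarrow> 'k) \<Rightarrow> 'x set" where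
  "supp R X f = {x \<in> X. f x \<noteq> \<zero>\<^bsub>R\<^esub>}"

text \<open>A formal sum is its coefficient function, extensional on \<open>X\<close> and of finite support.
  The coefficient of \<open>z\<close> in a product is the sum of \<open>f x \<otimes> g y\<close> over all \<open>x\<close>, \<open>y\<close> with
  \<open>x \<triangleright> y = z\<close>. In general this multiplication is neither associative nor unital; the
  ring record is used only for its operations, and its field \<open>one\<close> has no meaning here.\<close>

definition quandle_ring ::
  "('k, 'm) ring_scheme \<Rightarrow> 'x set \<Rightarrow> ('x \<Rightarrow> 'x \<Rightarrow> 'x) \<Rightarrow> ('x \<Rightarrow> 'k) ring" where
  "quandle_ring R X qop =
    \<lparr> carrier = {f \<in> X \<rightarrow>\<^sub>E carrier R. finite (supp R X f)},
      mult = (\<lambda>f g. \<lambda>z\<in>X. finsum R (\<lambda>(x, y). f x \<otimes>\<^bsub>R\<^esub> g y)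
        {(x, y) \<in> supp R X f \<times> supp R X g. qop x y = z}),
      one = undefined,
      zero = (\<lambda>x\<in>X. \<zero>\<^bsub>R\<^esub>),
      add = (\<lambda>f g. \<lambda>x\<in>X. f x \<oplus>\<^bsub>R\<^esub> g x) \<rparr>"

definition left_scale ::
  "('k, 'm) ring_scheme \<Rightarrow> 'x set \<Rightarrow> 'k \<Rightarrow> ('x \<Rightarrow> 'k) \<Rightarrow> 'x \<Rightarrow> 'k" where
  "left_scale R X c f = (\<lambda>x\<in>X. c \<otimes>\<^bsub>R\<^esub> f x)"

definition right_scale ::
  "('k, 'm) ring_scheme \<Rightarrow> 'x set \<Rightarrow> ('x \<Rightarrow> 'k) \<Rightarrow> 'k \<Rightarrow> 'x \<Rightarrow> 'k" where
  "right_scale R X f c = (\<lambda>x\<in>X. f x \<otimes>\<^bsub>R\<^esub> c)"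

definition left_ideal :: "('a, 'm) ring_scheme \<Rightarrow> 'a set \<Rightarrow> bool" where
  "left_ideal R I \<longleftrightarrow> additive_subgroup I R \<and> (\<forall>a\<in>carrier R. \<forall>x\<in>I. a \<otimes>\<^bsub>R\<^esub> x \<in> I)"

definition right_ideal :: "('a, 'm) ring_scheme \<Rightarrow> 'a set \<Rightarrow> bool" where
  "right_ideal R I \<longleftrightarrow> additive_subgroup I R \<and> (\<forall>a\<in>carrier R. \<forall>x\<in>I. x \<otimes>\<^bsub>R\<^esub> a \<in> I)"

text \<open>For a quandle ring, closure under scalars is an additional requirement: without a unit it
  does not follow from closure under multiplication.\<close>

definition quandle_ring_left_ideal ::
  "('k, 'm) ring_scheme \<Rightarrow> 'x set \<Rightarrow> ('x \<Rightarrow> 'x \<Rightarrow> 'x) \<Rightarrow> ('x \<Rightarrow> 'k) set \<Rightarrow> bool" where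
  "quandle_ring_left_ideal R X qop I \<longleftrightarrow>
    left_ideal (quandle_ring R X qop) I \<and> (\<forall>c\<in>carrier R. \<forall>f\<in>I. left_scale R X c f \<in> I)"

definition quandle_ring_right_ideal ::
  "('k, 'm) ring_scheme \<Rightarrow> 'x set \<Rightarrow> ('x \<Rightarrow> 'x \<Rightarrow> 'x) \<Rightarrow> ('x \<Rightarrow> 'k) set \<Rightarrow> bool" where
  "quandle_ring_right_ideal R X qop I \<longleftrightarrow>
    right_ideal (quandle_ring R X qop) I \<and> (\<forall>c\<in>carrier R. \<forall>f\<in>I. right_scale R X f c \<in> I)"

definition ascending_chain_condition :: "('a set \<Rightarrow> bool) \<Rightarrow> bool" where
  "ascending_chain_condition P \<longleftrightarrow>
    (\<forall>I :: nat \<Rightarrow> 'a set. (\<forall>n. P (I n)) \<and> (\<forall>n. I n \<subseteq> I (Suc n)) \<longrightarrow> (\<exists>N. \<forall>n\<ge>N. I n = I N))"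

text \<open>The library's locale \<open>noetherian_ring\<close> concerns two-sided ideals, so it is not the notion
  needed for a noncommutative coefficient ring.\<close>

definition noetherian :: "('a, 'm) ring_scheme \<Rightarrow> bool" where
  "noetherian R \<longleftrightarrow>
    ascending_chain_condition (left_ideal R) \<and> ascending_chain_condition (right_ideal R)"

definition quandle_ring_left_noetherian ::
  "('k, 'm) ring_scheme \<Rightarrow> 'x set \<Rightarrow> ('x \<Rightarrow> 'x \<Rightarrow> 'x) \<Rightarrow> bool" where
  "quandle_ring_left_noetherian R X qop \<longleftrightarrow>
    ascending_chain_condition (quandle_ring_left_ideal R X qop)"

definition quandle_ring_right_noetherian ::
  "('k, 'm) ring_scheme \<Rightarrow> 'x set \<Rightarrow> ('x \<Rightarrow> 'x \<Rightarrow> 'x) \<Rightarrow> bool" where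
  "quandle_ring_right_noetherian R X qop \<longleftrightarrow>
    ascending_chain_condition (quandle_ring_right_ideal R X qop)"

end

(* As a module over the coefficients, k[X] is the free module on the finite set X, so it suffices that
   ascending chains of submodules of k^X stabilize. This goes by induction on the set of coordinates
   that may be nonzero: for a coordinate a, a chain is determined by its intersections with the
   submodule {f. f a = 0} and by its images under f |-> f a, which are one-sided ideals of k. *)
theory Submission
  imports Defs
begin

text \<open>The scalar action \<open>act\<close> is an arbitrary map, so that one notion covers left
  and right ideals of \<open>R\<close> as well as left and right submodules of the quandle
  ring.\<close>

definition scalar_stable_subgroup ::
  "('a, 'm) ring_scheme \<Rightarrow> 'c set \<Rightarrow> ('c \<Rightarrow> 'a \<Rightarrow> 'a) \<Rightarrow> 'a set \<Rightarrow> bool" where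
  "scalar_stable_subgroup G C act I \<longleftrightarrow>
    additive_subgroup I G \<and> (\<forall>c\<in>C. \<forall>x\<in>I. act c x \<in> I)"

lemma ascending_chain_condition_mono:
  assumes "ascending_chain_condition P" and "\<And>I. Q I \<Longrightarrow> P I"
  shows "ascending_chain_condition Q"
  using assms unfolding ascending_chain_condition_def by meson

lemma (in abelian_group) additive_subgroup_minus_closed:
  assumes "additive_subgroup H G" "x \<in> H" "y \<in> H"
  shows "x \<ominus> y \<in> H"
  using assms additive_subgroup.a_closed additive_subgroup.a_inv_closed
  unfolding a_minus_def by metis

text \<open>Negatives arise as \<open>\<zero> \<ominus> x\<close> and sums as
  \<open>x \<ominus> (\<ominus> y)\<close>. The criterion suits kernels and images of evaluation at
  a coordinate, since evaluation respects differences.\<close>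

lemma (in abelian_group) additive_subgroup_of_minus_closed:
  assumes sub: "H \<subseteq> carrier G" and zero: "\<zero> \<in> H"
    and minus: "\<And>x y. x \<in> H \<Longrightarrow> y \<in> H \<Longrightarrow> x \<ominus> y \<in> H"
  shows "additive_subgroup H G"
proof -
  have neg: "\<ominus> x \<in> H" if "x \<in> H" for x
    using minus[OF zero that] sub that by (auto simp: a_minus_def)
  have "x \<oplus> y \<in> H" if "x \<in> H" "y \<in> H" for x y
    using minus[OF that(1) neg[OF that(2)]] sub that by (auto simp: a_minus_def)
  then have "subgroup H (add_monoid G)"
    using neg sub zero by (intro add.subgroupI) auto
  then show ?thesis
    by (rule additive_subgroupI)
qed

context
  fixes R :: "('k, 'm) ring_scheme" and X :: "'x set" and qop :: "'x \<Rightarrow> 'x \<Rightarrow> 'x"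
  assumes abelian: "abelian_group R" and fin: "finite X"
begin

interpretation R: abelian_group R
  by (rule abelian)

abbreviation (input) Q where "Q \<equiv> quandle_ring R X qop"

text \<open>Supports are subsets of the finite set \<open>X\<close>, hence finite, so the carrier is
  the full power of \<open>carrier R\<close>.\<close>

lemma carrier_quandle_ring: "carrier Q = X \<rightarrow>\<^sub>E carrier R"
  using fin by (auto simp: quandle_ring_def supp_def)

lemma zero_quandle_ring: "\<zero>\<^bsub>Q\<^esub> = (\<lambda>x\<in>X. \<zero>\<^bsub>R\<^esub>)"
  by (simp add: quandle_ring_def)

lemma add_quandle_ring: "f \<oplus>\<^bsub>Q\<^esub> g = (\<lambda>x\<in>X. f x \<oplus>\<^bsub>R\<^esub> g x)"
  by (simp add: quandle_ring_def)

lemma abelian_group_quandle_ring: "abelian_group Q"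
proof (rule abelian_groupI)
  fix f assume f: "f \<in> carrier Q"
  show "\<exists>g\<in>carrier Q. g \<oplus>\<^bsub>Q\<^esub> f = \<zero>\<^bsub>Q\<^esub>"
    using f by (intro bexI[of _ "\<lambda>x\<in>X. \<ominus>\<^bsub>R\<^esub> f x"])
      (auto simp: carrier_quandle_ring zero_quandle_ring add_quandle_ring PiE_iff R.l_neg
        intro!: restrict_ext)
qed (auto simp: carrier_quandle_ring zero_quandle_ring add_quandle_ring PiE_iff fun_eq_iff
      R.a_ac extensional_def)

interpretation Q: abelian_group Q
  by (rule abelian_group_quandle_ring)

text \<open>Negation in \<open>Q\<close> comes abstractly from its addition; uniqueness of additive
  inverses identifies it with pointwise negation.\<close>

lemma minus_quandle_ring_apply:
  assumes "f \<in> carrier Q" "g \<in> carrier Q" "x \<in> X"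
  shows "(f \<ominus>\<^bsub>Q\<^esub> g) x = f x \<ominus>\<^bsub>R\<^esub> g x"
proof -
  have "\<ominus>\<^bsub>Q\<^esub> g = (\<lambda>x\<in>X. \<ominus>\<^bsub>R\<^esub> g x)"
    using assms(2)
    by (intro Q.minus_equality)
      (auto simp: carrier_quandle_ring zero_quandle_ring add_quandle_ring PiE_iff R.l_neg
        intro!: restrict_ext)
  with assms(3) show ?thesis
    by (simp add: a_minus_def add_quandle_ring)
qed

text \<open>With \<open>act\<close> a one-sided multiplication of \<open>R\<close>, this is the
  statement that a finite free module over a Noetherian ring is Noetherian. The assumption
  \<open>act_zero\<close> keeps the functions vanishing at a given coordinate stable under
  scalars.\<close>

lemma ascending_chain_condition_pointwise:
  fixes C :: "'c set" and act :: "'c \<Rightarrow> 'k \<Rightarrow> 'k"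
  assumes acc: "ascending_chain_condition (scalar_stable_subgroup R C act)"
    and act_zero: "\<And>c. c \<in> C \<Longrightarrow> act c \<zero>\<^bsub>R\<^esub> = \<zero>\<^bsub>R\<^esub>"
  shows "ascending_chain_condition (scalar_stable_subgroup Q C (\<lambda>c f. \<lambda>x\<in>X. act c (f x)))"
    (is "ascending_chain_condition ?good")
proof -
  \<comment> \<open>The chain \<open>M\<close> is kept general because the induction hypothesis is
    applied to a different chain, that of the kernels \<open>K\<close>. For \<open>S = X\<close> the
    vanishing condition is vacuous.\<close>
  have stab: "\<exists>N. \<forall>n\<ge>N. M n = M N"
    if "finite S" "S \<subseteq> X" "\<And>n. ?good (M n)" "\<And>n. M n \<subseteq> M (Suc n)"
      "\<And>n f x. f \<in> M n \<Longrightarrow> x \<in> X - S \<Longrightarrow> f x = \<zero>\<^bsub>R\<^esub>"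
    for S and M :: "nat \<Rightarrow> ('x \<Rightarrow> 'k) set"
    using that
  proof (induction S arbitrary: M rule: finite_induct)
    case empty
    \<comment> \<open>All values on \<open>X\<close> vanish and elements of the carrier are
      extensional, so only the zero function remains.\<close>
    have "M n = {\<zero>\<^bsub>Q\<^esub>}" for n
    proof -
      have sg: "additive_subgroup (M n) Q"
        using empty(2) by (simp add: scalar_stable_subgroup_def)
      have "f = \<zero>\<^bsub>Q\<^esub>" if "f \<in> M n" for f
        using empty(4)[OF that] additive_subgroup.a_subset[OF sg] that
        by (fastforce simp: carrier_quandle_ring zero_quandle_ring PiE_iff extensional_def
            fun_eq_iff)
      then show ?thesis
        using additive_subgroup.zero_closed[OF sg] by blast
    qed
    then show ?case by simp
  next
    case (insert a S)
    note good = insert.prems(2) and vanish = insert.prems(4)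
    have aX: "a \<in> X"
      using insert.prems(1) by simp
    have sg: "additive_subgroup (M n) Q" for n
      using good by (simp add: scalar_stable_subgroup_def)
    have scale: "(\<lambda>x\<in>X. act c (f x)) \<in> M n" if "c \<in> C" "f \<in> M n" for c f n
      using good[of n] that unfolding scalar_stable_subgroup_def by blast
    have inQ: "f \<in> carrier Q" if "f \<in> M n" for f n
      using additive_subgroup.a_subset[OF sg] that by auto
    have minusM: "f \<ominus>\<^bsub>Q\<^esub> g \<in> M n" if "f \<in> M n" "g \<in> M n" for f g n
      using Q.additive_subgroup_minus_closed[OF sg that] .
    have minus_at: "(f \<ominus>\<^bsub>Q\<^esub> g) a = f a \<ominus>\<^bsub>R\<^esub> g a" if "f \<in> M n" "g \<in> M n" for f g n
      using minus_quandle_ring_apply inQ that aX by blast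
    have in_R: "f a \<in> carrier R" if "f \<in> M n" for f n
      using inQ[OF that] aX by (auto simp: carrier_quandle_ring)
    have zeroM: "\<zero>\<^bsub>Q\<^esub> \<in> M n" for n
      using additive_subgroup.zero_closed[OF sg] .
    have zero_at: "\<zero>\<^bsub>Q\<^esub> a = \<zero>\<^bsub>R\<^esub>"
      using aX by (simp add: zero_quandle_ring)
    have mono: "M m \<subseteq> M n" if "m \<le> n" for m n
      using that insert.prems(3) by (rule lift_Suc_mono_le[rotated])
    \<comment> \<open>Kernel and image of evaluation at \<open>a\<close> on \<open>M n\<close>.
      Elements of \<open>K n\<close> vanish at \<open>a\<close> too, hence outside \<open>S\<close>,
      so the induction hypothesis applies to \<open>K\<close>; the chain \<open>J\<close> lives in
      \<open>R\<close>, where \<open>acc\<close> applies.\<close>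
    define K where "K n = {f \<in> M n. f a = \<zero>\<^bsub>R\<^esub>}" for n
    define J where "J n = (\<lambda>f. f a) ` M n" for n
    have "\<exists>N. \<forall>n\<ge>N. K n = K N"
    proof (rule insert.IH)
      show "S \<subseteq> X" using insert.prems(1) by simp
      show "K n \<subseteq> K (Suc n)" for n
        using insert.prems(3) by (auto simp: K_def)
      show "f x = \<zero>\<^bsub>R\<^esub>" if "f \<in> K n" "x \<in> X - S" for n f x
        using that vanish by (cases "x = a") (auto simp: K_def)
      have K_sg: "additive_subgroup (K n) Q" for n
        by (rule Q.additive_subgroup_of_minus_closed)
          (auto simp: K_def inQ zeroM zero_at minusM minus_at R.minus_eq R.r_neg)
      have K_scale: "(\<lambda>x\<in>X. act c (f x)) \<in> K n" if "c \<in> C" "f \<in> K n" for c f n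
        using that scale[of c f n] aX by (simp add: K_def act_zero)
      show "?good (K n)" for n
        unfolding scalar_stable_subgroup_def using K_sg K_scale by blast
    qed
    then obtain N1 where N1: "\<And>n. n \<ge> N1 \<Longrightarrow> K n = K N1" by blast
    have "scalar_stable_subgroup R C act (J n)" for n
    proof -
      have "additive_subgroup (J n) R"
      proof (rule R.additive_subgroup_of_minus_closed)
        show "J n \<subseteq> carrier R" by (auto simp: J_def in_R)
        show "\<zero>\<^bsub>R\<^esub> \<in> J n" unfolding J_def using imageI[OF zeroM, of "\<lambda>f. f a" n] zero_at by metis
        show "u \<ominus>\<^bsub>R\<^esub> v \<in> J n" if "u \<in> J n" "v \<in> J n" for u v
          using that minusM minus_at unfolding J_def image_iff by metis
      qed
      moreover have "act c u \<in> J n" if c: "c \<in> C" and "u \<in> J n" for c u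
      proof -
        from \<open>u \<in> J n\<close> obtain f where "f \<in> M n" "u = f a" by (auto simp: J_def)
        with scale[OF c, of f n] aX show ?thesis
          unfolding J_def by (intro image_eqI) auto
      qed
      ultimately show ?thesis by (simp add: scalar_stable_subgroup_def)
    qed
    moreover have "J n \<subseteq> J (Suc n)" for n
      using insert.prems(3) by (auto simp: J_def)
    ultimately obtain N2 where N2: "\<And>n. n \<ge> N2 \<Longrightarrow> J n = J N2"
      using acc unfolding ascending_chain_condition_def by blast
    define N where "N = max N1 N2"
    \<comment> \<open>Since \<open>J n = J N\<close>, each \<open>f\<close> in \<open>M n\<close>
      shares its value at \<open>a\<close> with some \<open>g\<close> in \<open>M N\<close>. Their
      difference, formed in the larger \<open>M n\<close>, lies in \<open>K n = K N\<close>, hence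
      in \<open>M N\<close>; adding \<open>g\<close> back recovers \<open>f\<close>.\<close>
    have "M n \<subseteq> M N" if n: "n \<ge> N" for n
    proof
      fix f assume f: "f \<in> M n"
      have "f a \<in> J n"
        using f by (simp add: J_def)
      also have "J n = J N"
        using N2[of n] N2[of N] n by (simp add: N_def)
      finally obtain g where g: "g \<in> M N" "g a = f a"
        by (auto simp: J_def)
      have gn: "g \<in> M n" using g mono[OF n] by auto
      have "f \<ominus>\<^bsub>Q\<^esub> g \<in> K n"
        using f gn g(2) by (simp add: K_def minusM minus_at[of _ n] in_R R.minus_eq R.r_neg)
      also have "K n = K N"
        using N1[of n] N1[of N] n by (simp add: N_def)
      finally have "f \<ominus>\<^bsub>Q\<^esub> g \<in> M N" by (simp add: K_def)
      then have "(f \<ominus>\<^bsub>Q\<^esub> g) \<oplus>\<^bsub>Q\<^esub> g \<in> M N"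
        using g(1) additive_subgroup.a_closed[OF sg] by blast
      moreover have "(f \<ominus>\<^bsub>Q\<^esub> g) \<oplus>\<^bsub>Q\<^esub> g = f"
        using inQ[OF f] inQ[OF gn] by (simp add: Q.minus_eq Q.a_assoc Q.l_neg)
      ultimately show "f \<in> M N" by simp
    qed
    then show ?case using mono by blast
  qed
  show ?thesis
    unfolding ascending_chain_condition_def using stab[OF fin subset_refl] by auto
qed

end

theorem proposition4p5:
  fixes R :: "('k, 'm) ring_scheme" and X :: "'x set" and qop :: "'x \<Rightarrow> 'x \<Rightarrow> 'x"
  assumes "quandle X qop" and "finite X"
    and "ring R" and "noetherian R"
  shows "quandle_ring_left_noetherian R X qop \<and> quandle_ring_right_noetherian R X qop"
proof
  interpret R: ring R by fact
  note pointwise = ascending_chain_condition_pointwise[OF R.abelian_group_axioms \<open>finite X\<close>]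
  \<comment> \<open>For left multiplication by elements of \<open>R\<close>, the stable subgroups
    are exactly the left ideals.\<close>
  have "ascending_chain_condition (scalar_stable_subgroup R (carrier R) (\<lambda>c x. c \<otimes>\<^bsub>R\<^esub> x))"
    using \<open>noetherian R\<close>
    by (simp add: noetherian_def left_ideal_def[abs_def] scalar_stable_subgroup_def[abs_def])
  \<comment> \<open>An ideal of the quandle ring is in particular a submodule, so chains of ideals
    are chains of submodules. The concluding \<open>auto\<close> also settles the premise
    \<open>act_zero\<close>, here that a scalar times zero is zero.\<close>
  from pointwise[OF this, of qop] show "quandle_ring_left_noetherian R X qop"
    unfolding quandle_ring_left_noetherian_def
    by (rule ascending_chain_condition_mono)
      (auto simp: quandle_ring_left_ideal_def left_ideal_def left_scale_def
        scalar_stable_subgroup_def)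
  \<comment> \<open>The same argument on the other side: the scalar remains the first argument of
    the action but multiplies from the right.\<close>
  have "ascending_chain_condition (scalar_stable_subgroup R (carrier R) (\<lambda>c x. x \<otimes>\<^bsub>R\<^esub> c))"
    using \<open>noetherian R\<close>
    by (simp add: noetherian_def right_ideal_def[abs_def] scalar_stable_subgroup_def[abs_def])
  from pointwise[OF this, of qop] show "quandle_ring_right_noetherian R X qop"
    unfolding quandle_ring_right_noetherian_def
    by (rule ascending_chain_condition_mono)
      (auto simp: quandle_ring_right_ideal_def right_ideal_def right_scale_def
        scalar_stable_subgroup_def)
qed

end
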